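(* Let $n$ be an odd positive integer and let $\mathcal{R}_n$ be the dihedral quandle on $\mathbb{Z}_n$. Then the Peirce spectrum of the complex quandle algebra $\mathbb{C}[\mathcal{R}_n]$ is $\{0,1,-1\}$.
   Context: The dihedral quandle $\mathcal{R}_n$ is the set $\mathbb{Z}_n=\mathbb{Z}/n\mathbb{Z}$ with the binary operation $x\triangleright y = 2y-x$. The complex quandle algebra $\mathbb{C}[\mathcal{R}_n]$ is the (in general nonassociative) $\mathbb{C}$-algebra with $\mathbb{C}$-basis $\{e_x : x\in\mathbb{Z}_n\}$ and multiplication defined by bilinear extension of $e_xe_y=e_{x\triangleright y}=e_{2y-x}$. An idempotent is an element $u$ with $u^2=u$ (the element $0$ is included). For an idempotent $u\in\mathbb{C}[\mathcal{R}_n]$, let $S_u:\mathbb{C}[\mathcal{R}_n]\to\mathbb{C}[\mathcal{R}_n]$ be the $\mathbb{C}$-linear map $S_u(w)=wu$. The Peirce spectrum of $\mathbb{C}[\mathcal{R}_n]$ is the set of all complex numbers that are eigenvalues of $S_u$ for some idempotent $u$ of $\mathbb{C}[\mathcal{R}_n]$.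
   Formalization: The case n = 1 is excluded: there the algebra is C, its only idempotents are 0 and 1, and the Peirce spectrum is {0,1}, so the claim fails; the theorem is stated for all odd n other than 1. *)

theory Defs
  imports Complex_Main
begin

text \<open>
  Elements of the algebra \<open>\<complex>[Q]\<close> of a finite quandle with underlying set \<open>Q\<close> and operation \<open>opr\<close>
  are represented by their coordinate functions with respect to the basis
  \<open>{e\<^sub>x | x \<in> Q}\<close>, extended by \<open>0\<close> outside \<open>Q\<close>.
\<close>

definition quandle_algebra :: "'a set \<Rightarrow> ('a \<Rightarrow> complex) set" where
  "quandle_algebra Q = {f. \<forall>x. x \<notin> Q \<longrightarrow> f x = 0}"

definition basis_elt :: "'a \<Rightarrow> 'a \<Rightarrow> complex" where
  "basis_elt x = (\<lambda>z. if z = x then 1 else 0)"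

text \<open>
  Bilinear extension: \<open>(\<Sum>\<^sub>x f\<^sub>x e\<^sub>x) (\<Sum>\<^sub>y g\<^sub>y e\<^sub>y) = \<Sum>\<^sub>x \<Sum>\<^sub>y f\<^sub>x g\<^sub>y e\<^bsub>opr x y\<^esub>\<close>.
\<close>

definition qa_mult ::
  "'a set \<Rightarrow> ('a \<Rightarrow> 'a \<Rightarrow> 'a) \<Rightarrow> ('a \<Rightarrow> complex) \<Rightarrow> ('a \<Rightarrow> complex) \<Rightarrow> 'a \<Rightarrow> complex" where
  "qa_mult Q opr f g = (\<lambda>z. \<Sum>x\<in>Q. \<Sum>y\<in>Q. f x * g y * basis_elt (opr x y) z)"

definition idempotents :: "'a set \<Rightarrow> ('a \<Rightarrow> 'a \<Rightarrow> 'a) \<Rightarrow> ('a \<Rightarrow> complex) set" where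
  "idempotents Q opr = {u \<in> quandle_algebra Q. qa_mult Q opr u u = u}"

definition right_mult ::
  "'a set \<Rightarrow> ('a \<Rightarrow> 'a \<Rightarrow> 'a) \<Rightarrow> ('a \<Rightarrow> complex) \<Rightarrow> ('a \<Rightarrow> complex) \<Rightarrow> 'a \<Rightarrow> complex" where
  "right_mult Q opr u = (\<lambda>w. qa_mult Q opr w u)"

definition is_eigenvalue ::
  "'a set \<Rightarrow> (('a \<Rightarrow> complex) \<Rightarrow> 'a \<Rightarrow> complex) \<Rightarrow> complex \<Rightarrow> bool" where
  "is_eigenvalue Q S c \<longleftrightarrow>
     (\<exists>w \<in> quandle_algebra Q. w \<noteq> (\<lambda>x. 0) \<and> S w = (\<lambda>x. c * w x))"

definition peirce_spectrum :: "'a set \<Rightarrow> ('a \<Rightarrow> 'a \<Rightarrow> 'a) \<Rightarrow> complex set" where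
  "peirce_spectrum Q opr = {c. \<exists>u \<in> idempotents Q opr. is_eigenvalue Q (right_mult Q opr u) c}"

text \<open>\<open>\<int>\<^sub>n\<close> is represented by the residues \<open>0, \<dots>, n - 1\<close>.\<close>

definition dihedral_carrier :: "nat \<Rightarrow> int set" where
  "dihedral_carrier n = {0..<int n}"

definition dihedral_op :: "nat \<Rightarrow> int \<Rightarrow> int \<Rightarrow> int" where
  "dihedral_op n x y = (2 * y - x) mod int n"

lemma qa_mult_basis_elt:
  assumes "finite Q" "a \<in> Q" "b \<in> Q"
  shows "qa_mult Q opr (basis_elt a) (basis_elt b) = basis_elt (opr a b)"
proof
  fix z
  have "qa_mult Q opr (basis_elt a) (basis_elt b) z =
      (\<Sum>x\<in>Q. \<Sum>y\<in>Q. if y = b then if x = a then basis_elt (opr a b) z else 0 else 0)"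
    unfolding qa_mult_def by (intro sum.cong refl) (auto simp: basis_elt_def)
  also have "\<dots> = basis_elt (opr a b) z"
    using assms by (simp add: sum.delta)
  finally show "qa_mult Q opr (basis_elt a) (basis_elt b) z = basis_elt (opr a b) z" .
qed

lemma qa_mult_closed:
  assumes "\<And>x y. x \<in> Q \<Longrightarrow> y \<in> Q \<Longrightarrow> opr x y \<in> Q"
  shows "qa_mult Q opr f g \<in> quandle_algebra Q"
proof -
  have "qa_mult Q opr f g z = 0" if "z \<notin> Q" for z
    unfolding qa_mult_def
    by (intro sum.neutral ballI) (use assms that in \<open>auto simp: basis_elt_def\<close>)
  then show ?thesis by (simp add: quandle_algebra_def)
qed

lemma dihedral_op_closed:
  assumes "x \<in> dihedral_carrier n" "y \<in> dihedral_carrier n"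
  shows "dihedral_op n x y \<in> dihedral_carrier n"
  using assms by (auto simp: dihedral_carrier_def dihedral_op_def)

text \<open>
  The one-element quandle is exceptional: its algebra is \<open>\<complex>\<close>, so \<open>-1\<close> does not occur.
\<close>

lemma peirce_spectrum_dihedral_1:
  "peirce_spectrum (dihedral_carrier 1) (dihedral_op 1) = {0, 1}"
proof -
  have carr: "dihedral_carrier 1 = {0}" by (auto simp: dihedral_carrier_def)
  have mult: "qa_mult {0} (dihedral_op 1) f g = (\<lambda>z. f 0 * g 0 * basis_elt 0 z)" for f g
    by (simp add: qa_mult_def dihedral_op_def)
  have alg: "f = (\<lambda>z. f 0 * basis_elt 0 z)" if "f \<in> quandle_algebra {0}" for f :: "int \<Rightarrow> complex"
    using that by (auto simp: quandle_algebra_def basis_elt_def)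
  have "c = 0 \<or> c = 1" if "c \<in> peirce_spectrum {0} (dihedral_op 1)" for c
  proof -
    from that obtain u w where u: "u \<in> quandle_algebra {0}" "qa_mult {0} (dihedral_op 1) u u = u"
      and w: "w \<in> quandle_algebra {0}" "w \<noteq> (\<lambda>x. 0)"
        "qa_mult {0} (dihedral_op 1) w u = (\<lambda>x. c * w x)"
      by (auto simp: peirce_spectrum_def idempotents_def is_eigenvalue_def right_mult_def)
    have "w 0 \<noteq> 0" using alg[OF w(1)] w(2) by force
    moreover have "w 0 * u 0 = c * w 0"
      using fun_cong[OF w(3), of 0] unfolding mult by (simp add: basis_elt_def)
    moreover have "u 0 * u 0 = u 0"
      using fun_cong[OF u(2), of 0] unfolding mult by (simp add: basis_elt_def)
    ultimately show ?thesis by auto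
  qed
  moreover have "c \<in> peirce_spectrum {0} (dihedral_op 1)" if "c = 0 \<or> c = 1" for c
  proof -
    let ?u = "\<lambda>z. c * basis_elt (0::int) z"
    have "?u \<in> idempotents {0} (dihedral_op 1)"
      using that unfolding idempotents_def mult
      by (auto simp: quandle_algebra_def basis_elt_def)
    moreover have "is_eigenvalue {0} (right_mult {0} (dihedral_op 1) ?u) c"
      unfolding is_eigenvalue_def right_mult_def mult
      by (rule bexI[of _ "basis_elt 0"])
        (auto simp: quandle_algebra_def basis_elt_def fun_eq_iff)
    ultimately show ?thesis by (auto simp: peirce_spectrum_def)
  qed
  ultimately show ?thesis unfolding carr by auto
qed

end

theory Submission
  imports Defs "HOL-Number_Theory.Residues"
begin

text \<open>
  The discrete Fourier transform sends the product \<open>w u\<close> to \<open>k \<mapsto> W (-k) * U (2k)\<close>.  For an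
  idempotent \<open>u\<close> the numbers \<open>P k = U k * U (-k)\<close> therefore satisfy \<open>P k = P k * P (2k)\<close>;
  since doubling permutes \<open>\<int>\<^sub>n\<close> for odd \<open>n\<close>, going once around a doubling cycle gives
  \<open>P k \<in> {0, 1}\<close>.  Applying \<open>S\<^sub>u\<close> twice to an eigenvector multiplies its \<open>k\<close>-th Fourier coefficient
  by \<open>P (2k)\<close>, so an eigenvalue \<open>c\<close> satisfies \<open>c\<^sup>2 \<in> {0, 1}\<close>.  Conversely, \<open>0\<close> comes from \<open>u = 0\<close>,
  and \<open>\<plusminus>1\<close> come from \<open>u = e\<^sub>0\<close>, for which \<open>S\<^sub>u\<close> is the reflection \<open>e\<^sub>x \<mapsto> e\<^sub>-\<^sub>x\<close>.
\<close>

definition unity_char :: "nat \<Rightarrow> int \<Rightarrow> complex" where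
  "unity_char n j = cis (2 * pi * of_int j / of_nat n)"

text \<open>Frequencies range over all integers, so \<open>- k\<close> and \<open>2 * k\<close> need
  no reduction; \<open>dft_mod\<close> shows that only the residue class of \<open>k\<close>
  matters.\<close>

definition dft :: "nat \<Rightarrow> (int \<Rightarrow> complex) \<Rightarrow> int \<Rightarrow> complex" where
  "dft n f k = (\<Sum>x\<in>dihedral_carrier n. f x * unity_char n (k * x))"

lemma unity_char_0 [simp]: "unity_char n 0 = 1"
  by (simp add: unity_char_def)

lemma unity_char_add: "unity_char n (i + j) = unity_char n i * unity_char n j"
  by (simp add: unity_char_def cis_mult add_divide_distrib ring_distribs)

lemma unity_char_mult_nat: "unity_char n (int m * j) = unity_char n j ^ m"
  by (simp add: unity_char_def DeMoivre mult_ac)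

lemma unity_char_period:
  assumes "n > 0"
  shows "unity_char n (int n * j) = 1"
proof -
  have "unity_char n (int n * j) = cis (2 * pi * of_int j)"
    using assms by (simp add: unity_char_def mult.assoc)
  also have "\<dots> = 1" by (rule cis_multiple_2pi) simp
  finally show ?thesis .
qed

lemma unity_char_mod:
  assumes "n > 0"
  shows "unity_char n (k * (j mod int n)) = unity_char n (k * j)"
proof -
  have "k * j = k * (j mod int n) + int n * (k * (j div int n))"
    by (metis distrib_left mult.left_commute mod_mult_div_eq)
  then show ?thesis
    using unity_char_period[OF assms] by (simp add: unity_char_add)
qed

lemma unity_char_eq_1_imp_dvd:
  assumes "n > 0" "unity_char n j = 1"
  shows "int n dvd j"
proof -
  have "cos (2 * pi * of_int j / of_nat n) = 1"
    using assms(2) by (metis unity_char_def cis.sel(1) one_complex.sel(1))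
  then obtain m :: int where "2 * pi * of_int j / of_nat n = of_int m * 2 * pi"
    by (auto simp: cos_one_2pi_int)
  then have "real_of_int j = of_int m * of_nat n"
    using assms(1) by (simp add: field_simps)
  then have "j = m * int n"
    by (metis of_int_eq_iff of_int_mult of_int_of_nat_eq)
  then show ?thesis by simp
qed

text \<open>A geometric sum whose ratio \<open>unity_char n j\<close> is an n-th root of unity
  different from 1.\<close>

lemma sum_unity_char_eq_0:
  assumes "n > 0" "\<not> int n dvd j"
  shows "(\<Sum>k<n. unity_char n (int k * j)) = 0"
proof -
  have "unity_char n j \<noteq> 1"
    using assms unity_char_eq_1_imp_dvd by blast
  moreover have "unity_char n j ^ n = 1"
    using unity_char_period[OF assms(1)] by (simp flip: unity_char_mult_nat)
  ultimately show ?thesis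
    by (simp add: unity_char_mult_nat geometric_sum)
qed

text \<open>Orthogonality of characters: after swapping the sums, the inner sum is \<open>n\<close>
  for \<open>x = y\<close> and vanishes otherwise, since distinct elements of the carrier are
  incongruent mod \<open>n\<close>.\<close>

lemma dft_inversion:
  assumes "n > 0" "y \<in> dihedral_carrier n"
  shows "(\<Sum>k<n. dft n f (int k) * unity_char n (- (int k * y))) = of_nat n * f y"
proof -
  have "(\<Sum>k<n. dft n f (int k) * unity_char n (- (int k * y)))
      = (\<Sum>k<n. \<Sum>x\<in>dihedral_carrier n. f x * unity_char n (int k * (x - y)))"
    by (simp add: dft_def sum_distrib_right mult.assoc right_diff_distrib
        flip: unity_char_add)
  also have "\<dots> = (\<Sum>x\<in>dihedral_carrier n. f x * (\<Sum>k<n. unity_char n (int k * (x - y))))"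
    by (subst sum.swap) (simp add: sum_distrib_left)
  also have "\<dots> = (\<Sum>x\<in>dihedral_carrier n. if x = y then f y * of_nat n else 0)"
  proof (intro sum.cong refl)
    fix x assume x: "x \<in> dihedral_carrier n"
    show "f x * (\<Sum>k<n. unity_char n (int k * (x - y))) = (if x = y then f y * of_nat n else 0)"
    proof (cases "x = y")
      case False
      have "x mod int n = x" "y mod int n = y"
        using x assms(2) by (auto simp: dihedral_carrier_def)
      then have "\<not> int n dvd x - y"
        using False by (metis mod_eq_dvd_iff)
      then show ?thesis
        using False sum_unity_char_eq_0[OF assms(1)] by simp
    qed simp
  qed
  also have "\<dots> = of_nat n * f y"
    using assms(2) by (simp add: dihedral_carrier_def)
  finally show ?thesis .
qed

text \<open>Supplies a frequency at which a Fourier coefficient of an eigenvector can be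
  cancelled.\<close>

lemma dft_nonzero:
  assumes "n > 0" "f \<in> quandle_algebra (dihedral_carrier n)" "f \<noteq> (\<lambda>x. 0)"
  obtains k where "dft n f k \<noteq> 0"
proof -
  obtain y where y: "f y \<noteq> 0" using assms(3) by auto
  then have "y \<in> dihedral_carrier n"
    using assms(2) by (auto simp: quandle_algebra_def)
  then have "(\<Sum>k<n. dft n f (int k) * unity_char n (- (int k * y))) \<noteq> 0"
    using dft_inversion[OF assms(1), of y f] y assms(1) by simp
  then obtain k where "dft n f (int k) * unity_char n (- (int k * y)) \<noteq> 0"
    by (meson sum.not_neutral_contains_not_neutral)
  then show ?thesis using that by auto
qed

lemma dft_mod:
  assumes "n > 0" "[k = l] (mod int n)"
  shows "dft n f k = dft n f l"
proof -
  have "unity_char n (k * x) = unity_char n (l * x)" for x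
    \<comment> \<open>\<open>unity_char_mod\<close> reduces the second factor, so the frequency is
      moved there by commutativity.\<close>
    using unity_char_mod[OF assms(1), of x k] unity_char_mod[OF assms(1), of x l] assms(2)
    by (simp add: cong_def mult.commute[of _ x])
  then show ?thesis by (simp add: dft_def)
qed

text \<open>A character turns the sum \<open>k * (2 * y - x)\<close> into a product of a factor in
  \<open>x\<close> and a factor in \<open>y\<close>, so the double sum splits.\<close>

lemma dft_qa_mult:
  assumes "n > 0"
  shows "dft n (qa_mult (dihedral_carrier n) (dihedral_op n) f g) k
    = dft n f (- k) * dft n g (2 * k)"
proof -
  let ?Q = "dihedral_carrier n" and ?e = "unity_char n"
  have fin: "finite ?Q" by (simp add: dihedral_carrier_def)
  have "dft n (qa_mult ?Q (dihedral_op n) f g) k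
      = (\<Sum>z\<in>?Q. \<Sum>x\<in>?Q. \<Sum>y\<in>?Q. f x * g y * (basis_elt (dihedral_op n x y) z * ?e (k * z)))"
    by (simp add: dft_def qa_mult_def sum_distrib_right mult.assoc)
  also have "\<dots> = (\<Sum>x\<in>?Q. \<Sum>y\<in>?Q. \<Sum>z\<in>?Q. f x * g y * (basis_elt (dihedral_op n x y) z * ?e (k * z)))"
    by (subst sum.swap) (rule sum.cong[OF refl], rule sum.swap)
  also have "\<dots> = (\<Sum>x\<in>?Q. \<Sum>y\<in>?Q. (f x * ?e (- k * x)) * (g y * ?e (2 * k * y)))"
  proof (intro sum.cong refl)
    fix x y assume xy: "x \<in> ?Q" "y \<in> ?Q"
    have "(\<Sum>z\<in>?Q. f x * g y * (basis_elt (dihedral_op n x y) z * ?e (k * z)))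
        = (\<Sum>z\<in>?Q. if z = dihedral_op n x y then f x * g y * ?e (k * dihedral_op n x y) else 0)"
      by (intro sum.cong refl) (simp add: basis_elt_def)
    also have "\<dots> = f x * g y * ?e (k * dihedral_op n x y)"
      using fin dihedral_op_closed[OF xy] by simp
    also have "?e (k * dihedral_op n x y) = ?e (- k * x + 2 * k * y)"
      unfolding dihedral_op_def unity_char_mod[OF assms] by (simp add: algebra_simps)
    finally show "(\<Sum>z\<in>?Q. f x * g y * (basis_elt (dihedral_op n x y) z * ?e (k * z)))
        = (f x * ?e (- k * x)) * (g y * ?e (2 * k * y))"
      by (simp only: unity_char_add mult_ac)
  qed
  also have "\<dots> = dft n f (- k) * dft n g (2 * k)"
    by (simp add: dft_def sum_product)
  finally show ?thesis .
qed

lemma idempotent_dft_norm: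
  assumes "odd n" "u \<in> idempotents (dihedral_carrier n) (dihedral_op n)"
  shows "dft n u k * dft n u (- k) \<in> {0, 1}"
proof -
  define P where "P k = dft n u k * dft n u (- k)" for k
  have n: "n > 0" using assms(1) by (rule odd_pos)
  have U: "dft n u k = dft n u (- k) * dft n u (2 * k)" for k
    using dft_qa_mult[OF n, of u u k] assms(2) by (simp add: idempotents_def)
  \<comment> \<open>Multiply the instances of \<open>U\<close> at \<open>k\<close> and at
    \<open>- k\<close>.\<close>
  have "P k = P k * P (2 * k)" for k
    using U[of k] U[of "- k"] unfolding P_def
    by (metis minus_minus mult.assoc mult.commute mult_minus_right)
  then have double: "P k = 0 \<or> P (2 * k) = 1" for k
    by (metis mult_cancel_left mult.right_neutral)
  have "P k = 1" if "P k \<noteq> 0"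
  proof -
    \<comment> \<open>The induction starts at exponent 1: at \<open>k\<close> itself only
      \<open>P k \<noteq> 0\<close> is known, and each nonzero value forces the next one to be
      1.\<close>
    have "P (2 ^ Suc i * k) = 1" for i
    proof (induction i)
      case 0
      then show ?case using double[of k] that by simp
    next
      case (Suc i)
      then show ?case using double[of "2 ^ Suc i * k"] by (simp add: mult.assoc)
    qed
    \<comment> \<open>Euler's theorem applies because 2 is coprime to the odd \<open>n\<close>:
      after \<open>totient n\<close> doublings the orbit is back at \<open>k\<close>. This exponent
      is positive, as the induction requires.\<close>
    moreover obtain i where i: "totient n = Suc i"
      using n by (metis gr0_implies_Suc totient_gt_0_iff)
    ultimately have "P (2 ^ totient n * k) = 1" by simp
    moreover have "[2 ^ totient n = 1] (mod n)"
      using assms(1) by (intro euler_theorem) simp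
    then have "[2 ^ totient n = 1] (mod int n)"
      by (metis cong_int_iff of_nat_1 of_nat_numeral of_nat_power)
    then have "[2 ^ totient n * k = 1 * k] (mod int n)"
      by (rule cong_mult) simp
    then have "[2 ^ totient n * k = k] (mod int n)" by simp
    then have "P (2 ^ totient n * k) = P k"
      unfolding P_def using dft_mod[OF n] by (metis cong_minus_minus_iff)
    ultimately show ?thesis by simp
  qed
  then show ?thesis by (auto simp: P_def)
qed

lemma peirce_spectrum_dihedral_subset:
  assumes "odd n"
  shows "peirce_spectrum (dihedral_carrier n) (dihedral_op n) \<subseteq> {0, 1, -1}"
proof
  fix c assume "c \<in> peirce_spectrum (dihedral_carrier n) (dihedral_op n)"
  then obtain u w where u: "u \<in> idempotents (dihedral_carrier n) (dihedral_op n)"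
    and w: "w \<in> quandle_algebra (dihedral_carrier n)" "w \<noteq> (\<lambda>x. 0)"
      "qa_mult (dihedral_carrier n) (dihedral_op n) w u = (\<lambda>x. c * w x)"
    by (auto simp: peirce_spectrum_def is_eigenvalue_def right_mult_def)
  have n: "n > 0" using assms by (rule odd_pos)
  obtain k where k: "dft n w k \<noteq> 0"
    using dft_nonzero[OF n w(1,2)] .
  have eig: "c * dft n w k = dft n w (- k) * dft n u (2 * k)" for k
    using dft_qa_mult[OF n, of w u k]
    unfolding w(3) by (simp add: dft_def sum_distrib_left mult.assoc)
  \<comment> \<open>The equation at \<open>k\<close> brings in \<open>dft n w (- k)\<close>; a
    second factor \<open>c\<close> and the equation at \<open>- k\<close> lead back to
    \<open>dft n w k\<close>.\<close>
  have "c\<^sup>2 * dft n w k = (dft n u (2 * k) * dft n u (- (2 * k))) * dft n w k"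
    using eig[of k] eig[of "- k"]
    unfolding power2_eq_square by (metis minus_minus mult.assoc mult.commute mult_minus_right)
  then have "c\<^sup>2 = dft n u (2 * k) * dft n u (- (2 * k))" using k by simp
  then have "c\<^sup>2 \<in> {0, 1}" using idempotent_dft_norm[OF assms u] by simp
  then show "c \<in> {0, 1, -1}" by (auto simp: power2_eq_1_iff)
qed

lemma peirce_spectrumI:
  assumes "u \<in> idempotents Q opr" "w \<in> quandle_algebra Q" "w x \<noteq> 0"
    and "\<And>z. qa_mult Q opr w u z = c * w z"
  shows "c \<in> peirce_spectrum Q opr"
proof -
  have "w \<noteq> (\<lambda>x. 0)" using assms(3) by auto
  moreover have "qa_mult Q opr w u = (\<lambda>z. c * w z)" using assms(4) by (rule ext)
  ultimately show ?thesis
    using assms(1,2) unfolding peirce_spectrum_def is_eigenvalue_def right_mult_def by blast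
qed

lemma qa_mult_diff_left:
  "qa_mult Q opr (\<lambda>x. f x - g x) h z = qa_mult Q opr f h z - qa_mult Q opr g h z"
  by (simp add: qa_mult_def left_diff_distrib sum_subtractf)

theorem theorem3p2:
  fixes n :: nat
  assumes "odd n" and "n \<noteq> 1"
  shows "peirce_spectrum (dihedral_carrier n) (dihedral_op n) = {0, 1, -1}"
proof (rule antisym[OF peirce_spectrum_dihedral_subset[OF assms(1)]])
  let ?Q = "dihedral_carrier n" and ?op = "dihedral_op n"
  \<comment> \<open>Now 1 and \<open>int n - 1\<close> are distinct residues. For
    \<open>n = 1\<close> the reflection would be the identity, and -1 is not in the spectrum
    (\<open>peirce_spectrum_dihedral_1\<close>).\<close>
  have n: "n \<ge> 3"
    using assms by (cases "n = 0"; cases "n = 2") auto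
  have Q: "finite ?Q" "0 \<in> ?Q" "1 \<in> ?Q" "int n - 1 \<in> ?Q"
    using n by (auto simp: dihedral_carrier_def)
  have basis: "basis_elt x \<in> quandle_algebra ?Q" if "x \<in> ?Q" for x
    using that by (auto simp: quandle_algebra_def basis_elt_def)
  have op0: "?op 0 0 = 0" "?op 1 0 = int n - 1" "?op (int n - 1) 0 = 1"
    using n by (auto simp: dihedral_op_def zmod_minus1 mod_pos_pos_trivial)
  have mult0: "qa_mult ?Q ?op (basis_elt x) (basis_elt 0) = basis_elt (?op x 0)" if "x \<in> ?Q" for x
    using qa_mult_basis_elt Q that by metis
  have zero: "(\<lambda>x. 0) \<in> idempotents ?Q ?op"
    by (simp add: idempotents_def quandle_algebra_def qa_mult_def)
  have e0: "basis_elt 0 \<in> idempotents ?Q ?op"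
    using basis Q mult0 op0 by (simp add: idempotents_def)
  have "0 \<in> peirce_spectrum ?Q ?op"
    by (rule peirce_spectrumI[OF zero basis[OF Q(2)], of 0]) (simp_all add: basis_elt_def qa_mult_def)
  moreover have "1 \<in> peirce_spectrum ?Q ?op"
    by (rule peirce_spectrumI[OF e0 basis[OF Q(2)], of 0])
      (use Q mult0 op0 in \<open>simp_all add: basis_elt_def\<close>)
  moreover have "-1 \<in> peirce_spectrum ?Q ?op"
  \<comment> \<open>Right multiplication by \<open>basis_elt 0\<close> swaps the basis elements at 1
    and at \<open>int n - 1\<close>, hence negates their difference.\<close>
  proof (rule peirce_spectrumI[OF e0, of "\<lambda>x. basis_elt 1 x - basis_elt (int n - 1) x" 1])
    show "(\<lambda>x. basis_elt 1 x - basis_elt (int n - 1) x) \<in> quandle_algebra ?Q"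
      using basis Q by (simp add: quandle_algebra_def)
    show "basis_elt (1::int) 1 - basis_elt (int n - 1) 1 \<noteq> 0"
      using n by (simp add: basis_elt_def)
  qed (use Q mult0 op0 in \<open>simp add: qa_mult_diff_left\<close>)
  ultimately show "{0, 1, -1} \<subseteq> peirce_spectrum ?Q ?op" by simp
qed

end
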